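(* Let $n\ge1$, let $R=\mathbb Q[x_1,\dots,x_n]$, let $\bar\vartheta_1,\dots,\bar\vartheta_n$ be $n$ uncorrelated umbrae similar to the polynomial umbra $\bar\vartheta$, and let $V_n$ be the $n$-volume polynomial. Then $$V_n(\bar\vartheta_1,\ldots,\bar\vartheta_n)\simeq\mathcal{PF}_n,$$ where $\mathcal{PF}_n$ is the Frobenius characteristic of the parking function module, taken in the variables $x_1,\dots,x_n$.
   Context: **Parking functions.** A parking function of length $n$ is a sequence $\mathbf p=(p_1,\dots,p_n)$ of positive integers whose nondecreasing rearrangement $(p'_1,\dots,p'_n)$ satisfies $p'_j\le j$ for all $j$; $park(n)$ is the set of these. The $n$-volume polynomial in commuting variables $y_1,\dots,y_n$ is $V_n(y_1,\dots,y_n)=\frac1{n!}\sum_{\mathbf p\in park(n)}y_{p_1}\cdots y_{p_n}$. The parking function module is the $\mathbb Q$-vector space with basis $park(n)$, with the symmetric group $\mathfrak S_n$ acting by permuting the entries of parking functions; $\mathcal{PF}_n$ is the symmetric function associated with its character by the Frobenius map. All symmetric functions are taken in the variables $x_1,\dots,x_n$. **Umbral calculus (over $R=\mathbb Q[x_1,\dots,x_n]$).** One has an alphabet $A$ of symbols (umbrae; polynomial umbrae for this $R$) and an $R$-linear functional $E:R[A]\to R$ with $E[1]=1$ and $E[\alpha^i\gamma^j\cdots\delta^k]=E[\alpha^i]E[\gamma^j]\cdots E[\delta^k]$ for pairwise distinct umbrae (distinct umbrae are "uncorrelated"). The $i$-th moment of $\alpha$ is $E[\alpha^i]$. For polynomials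 $p,q$ in umbrae, $p\simeq q$ means $E[p]=E[q]$, and $p\equiv q$ (similarity) means $E[p^i]=E[q^i]$ for all $i\ge0$. The generating function is $f(\alpha,t)=\sum_{i\ge0}E[\alpha^i]\,t^i/i!$. The alphabet includes auxiliary umbrae, and as many uncorrelated copies of any umbra as needed. For an umbra $\alpha$, $-1\boldsymbol{.}\alpha$ is an auxiliary umbra with $f(-1\boldsymbol{.}\alpha,t)=f(\alpha,t)^{-1}$. **The umbra $\bar\vartheta$.** Let $\chi$ be the singleton umbra, $f(\chi,t)=1+t$. Let $\bar\epsilon\equiv\chi_1x_1+\cdots+\chi_nx_n$ with $\chi_1,\dots,\chi_n$ uncorrelated umbrae similar to $\chi$, so $f(\bar\epsilon,t)=\prod_{i=1}^n(1+x_it)$. Then $\bar\vartheta\equiv-1\boldsymbol{.}(-\bar\epsilon)$; thus $f(\bar\vartheta,t)=\prod_{i=1}^n(1-x_it)^{-1}=\sum_{i\ge0}h_it^i$, i.e. $E[\bar\vartheta^i]=i!\,h_i$, with $h_i$ the complete homogeneous symmetric function in $x_1,\dots,x_n$. *)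

theory Defs
  imports
    "HOL-Library.Poly_Mapping"
    "HOL-Library.Multiset"
    "HOL-Library.Cardinality"
    "HOL-Combinatorics.Permutations"
    "HOL-Combinatorics.Orbits"
    "HOL-Computational_Algebra.Formal_Power_Series"
begin

section \<open>Multivariate polynomials\<close>

text \<open>
  Polynomials in commuting variables indexed by the type \<open>'v\<close> with coefficients in \<open>'c\<close>:
  monomials are finitely supported exponent functions, and the ring structure is the convolution
  product on finitely supported functions.
\<close>

type_synonym ('v, 'c) mpoly = "('v \<Rightarrow>\<^sub>0 nat) \<Rightarrow>\<^sub>0 'c"

definition Var :: "'v \<Rightarrow> ('v, 'c::zero_neq_one) mpoly" where
  "Var v = Poly_Mapping.single (Poly_Mapping.single v 1) 1"

definition Const :: "'c \<Rightarrow> ('v, 'c::zero) mpoly" where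
  "Const c = Poly_Mapping.single 0 c"

text \<open>
  Substitution of elements \<open>y v\<close> of a commutative ring for the variables, where \<open>\<phi>\<close> embeds the
  coefficients into that ring.
\<close>

definition mpoly_subst ::
    "('c \<Rightarrow> 'r) \<Rightarrow> ('v \<Rightarrow> 'r) \<Rightarrow> ('v, 'c::zero) mpoly \<Rightarrow> 'r::comm_ring_1" where
  "mpoly_subst \<phi> y p =
     (\<Sum>m\<in>Poly_Mapping.keys p. \<phi> (Poly_Mapping.lookup p m) *
        (\<Prod>v\<in>Poly_Mapping.keys m. y v ^ Poly_Mapping.lookup m v))"


section \<open>Parking functions and volume polynomials\<close>

definition park :: "nat \<Rightarrow> nat list set" where
  "park n = {p. length p = n \<and> (\<forall>k\<in>set p. 0 < k) \<and> (\<forall>j<n. sort p ! j \<le> Suc j)}"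

definition volume_poly :: "nat \<Rightarrow> (nat, rat) mpoly" where
  "volume_poly n = Const (1 / fact n) * (\<Sum>p\<in>park n. \<Prod>i<n. Var (p ! i))"


section \<open>The parking function module and its Frobenius characteristic\<close>

text \<open>The symmetric group on \<open>n\<close> letters is \<open>{\<sigma>. \<sigma> permutes {..<n}}\<close>.\<close>

definition parking_module :: "nat \<Rightarrow> (nat list \<Rightarrow>\<^sub>0 rat) set" where
  "parking_module n = {v. Poly_Mapping.keys v \<subseteq> park n}"

text \<open>
  The action permutes positions. As \<open>permute_list \<sigma>\<close> puts the entry with index \<open>\<sigma> i\<close> in
  position \<open>i\<close>, the inverse is needed to obtain a left action.
\<close>

definition parking_action ::
    "(nat \<Rightarrow> nat) \<Rightarrow> (nat list \<Rightarrow>\<^sub>0 rat) \<Rightarrow> (nat list \<Rightarrow>\<^sub>0 rat)" where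
  "parking_action \<sigma> v =
     (\<Sum>p\<in>Poly_Mapping.keys v.
        Poly_Mapping.single (permute_list (inv \<sigma>) p) (Poly_Mapping.lookup v p))"

lemma parking_action_single:
  "parking_action \<sigma> (Poly_Mapping.single p c) = Poly_Mapping.single (permute_list (inv \<sigma>) p) c"
  by (cases "c = 0") (simp_all add: parking_action_def)

lemma parking_action_add:
  "parking_action \<sigma> (v + w) = parking_action \<sigma> v + parking_action \<sigma> w"
proof -
  have ext: "parking_action \<sigma> u = (\<Sum>p\<in>S. Poly_Mapping.single (permute_list (inv \<sigma>) p) (Poly_Mapping.lookup u p))"
    if "finite S" "Poly_Mapping.keys u \<subseteq> S" for u S
    unfolding parking_action_def using that
    by (intro sum.mono_neutral_left) (auto simp: in_keys_iff)
  let ?S = "Poly_Mapping.keys v \<union> Poly_Mapping.keys w"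
  show ?thesis
    using Poly_Mapping.keys_add[of v w]
    by (simp add: ext[of ?S] lookup_add single_add sum.distrib)
qed

lemma permute_list_park:
  assumes "\<sigma> permutes {..<n}" "p \<in> park n"
  shows "permute_list \<sigma> p \<in> park n"
proof -
  have "length p = n" using assms by (simp add: park_def)
  then have "mset (permute_list \<sigma> p) = mset p" using assms(1) by (simp add: mset_permute_list)
  then have "sort (permute_list \<sigma> p) = sort p" "set (permute_list \<sigma> p) = set p" 
    by (metis properties_for_sort mset_sort sorted_sort) (metis \<open>mset _ = _\<close> mset_eq_setD)
  then show ?thesis using assms by (simp add: park_def)
qed

lemma parking_action_mem:
  assumes "\<sigma> permutes {..<n}" "v \<in> parking_module n"
  shows "parking_action \<sigma> v \<in> parking_module n"
proof -
  have "Poly_Mapping.keys (parking_action \<sigma> v) \<subseteq> (\<Union>p\<in>Poly_Mapping.keys v. Poly_Mapping.keys (Poly_Mapping.single (permute_list (inv \<sigma>) p) (Poly_Mapping.lookup v p)))"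
    unfolding parking_action_def by (rule keys_sum)
  also have "\<dots> \<subseteq> park n"
    using assms permute_list_park[OF permutes_inv[OF assms(1)]] by (auto simp: parking_module_def split: if_splits)
  finally show ?thesis by (simp add: parking_module_def)
qed

lemma parking_action_compose_single:
  assumes "\<sigma> permutes {..<n}" "\<tau> permutes {..<n}" "length p = n"
  shows "parking_action (\<sigma> \<circ> \<tau>) (Poly_Mapping.single p c) = parking_action \<sigma> (parking_action \<tau> (Poly_Mapping.single p c))"
  using assms by (simp add: parking_action_single o_inv_distrib permutes_bij permutes_inv permute_list_compose)

text \<open>The trace, with respect to the basis \<open>B\<close>, of an operator on the free module on \<open>B\<close>.\<close>

definition basis_trace ::
    "'b set \<Rightarrow> (('b \<Rightarrow>\<^sub>0 'k) \<Rightarrow> ('b \<Rightarrow>\<^sub>0 'k)) \<Rightarrow> 'k::comm_ring_1" where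
  "basis_trace B T = (\<Sum>b\<in>B. Poly_Mapping.lookup (T (Poly_Mapping.single b 1)) b)"

definition parking_character :: "nat \<Rightarrow> (nat \<Rightarrow> nat) \<Rightarrow> rat" where
  "parking_character n \<sigma> = basis_trace (park n) (parking_action \<sigma>)"

definition cycle_type :: "nat \<Rightarrow> (nat \<Rightarrow> nat) \<Rightarrow> nat multiset" where
  "cycle_type n \<sigma> = image_mset card (mset_set (orbit \<sigma> ` {..<n}))"

definition power_sum :: "nat \<Rightarrow> ('v::finite, rat) mpoly" where
  "power_sum k = (\<Sum>i\<in>UNIV. Var i ^ k)"

definition power_sum_partition :: "nat multiset \<Rightarrow> ('v::finite, rat) mpoly" where
  "power_sum_partition \<mu> = (\<Prod>k\<in>#\<mu>. power_sum k)"

text \<open>The Frobenius map on class functions, in the finitely many variables indexed by \<open>'v\<close>.\<close>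

definition frobenius ::
    "nat \<Rightarrow> ((nat \<Rightarrow> nat) \<Rightarrow> rat) \<Rightarrow> ('v::finite, rat) mpoly" where
  "frobenius n f =
     Const (1 / fact n) *
       (\<Sum>\<sigma> | \<sigma> permutes {..<n}. Const (f \<sigma>) * power_sum_partition (cycle_type n \<sigma>))"

definition PF :: "nat \<Rightarrow> ('v::finite, rat) mpoly" where
  "PF n = frobenius n (parking_character n)"


section \<open>Umbral calculus\<close>

text \<open>
  The alphabet is the type \<open>'u\<close>; the ring $R$ is \<open>('v, rat) mpoly\<close>, and $R[A]$ is
  \<open>('u, ('v, rat) mpoly) mpoly\<close>. An umbra \<open>\<alpha>\<close> occurs in $R[A]$ as \<open>Var \<alpha>\<close>.
\<close>

type_synonym ('u, 'v) umbral_poly = "('u, ('v, rat) mpoly) mpoly"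

type_synonym ('u, 'v) umbral_fun = "('u, 'v) umbral_poly \<Rightarrow> ('v, rat) mpoly"

locale umbral_calculus =
  fixes E :: "('u, 'v) umbral_fun"
  assumes E_add: "E (p + q) = E p + E q"
    and E_scale: "E (Const c * p) = c * E p"
    and E_one: "E 1 = 1"
    and E_uncorrelated:
      "finite S \<Longrightarrow> E (\<Prod>\<alpha>\<in>S. Var \<alpha> ^ e \<alpha>) = (\<Prod>\<alpha>\<in>S. E (Var \<alpha> ^ e \<alpha>))"

text \<open>Moments can be prescribed arbitrarily, except that the zeroth ones are \<open>1\<close>.\<close>

lemma umbral_calculus_exists:
  fixes m :: "'u \<Rightarrow> nat \<Rightarrow> ('v, rat) mpoly"
  assumes m0: "\<And>a. m a 0 = 1"
  shows "\<exists>E. umbral_calculus E \<and> (\<forall>a i. E (Var a ^ i) = m a i)"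
proof -
  define w where "w k = (\<Prod>a\<in>Poly_Mapping.keys k. m a (Poly_Mapping.lookup k a))" for k :: "'u \<Rightarrow>\<^sub>0 nat"
  define E where "E p = (\<Sum>k\<in>Poly_Mapping.keys p. Poly_Mapping.lookup p k * w k)" for p :: "('u,'v) umbral_poly"
  have ext: "E p = (\<Sum>k\<in>S. Poly_Mapping.lookup p k * w k)" if "finite S" "Poly_Mapping.keys p \<subseteq> S" for p S
    unfolding E_def using that by (intro sum.mono_neutral_left) (auto simp: in_keys_iff)
  have add: "E (p + q) = E p + E q" for p q
    using Poly_Mapping.keys_add[of p q]
    ext[of "Poly_Mapping.keys p \<union> Poly_Mapping.keys q" p] ext[of "Poly_Mapping.keys p \<union> Poly_Mapping.keys q" q] ext[of "Poly_Mapping.keys p \<union> Poly_Mapping.keys q" "p+q"]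
 by (simp add: lookup_add sum.distrib distrib_right)
  have sing: "E (Poly_Mapping.single k c) = c * w k" for k c
    by (cases "c = 0") (auto simp: E_def)
  have E0: "E 0 = 0" by (simp add: E_def)
  have scale: "E (Const c * p) = c * E p" for c p
proof -
    have l: "Poly_Mapping.lookup (Const c * p) k = c * Poly_Mapping.lookup p k" for k
      by (simp add: Const_def flip: mult_map_scale_conv_mult) (simp add: map.rep_eq when_def)
    then show ?thesis
      using ext[of "Poly_Mapping.keys p" "Const c * p"] ext[of "Poly_Mapping.keys p" p] 
      by (simp add: l in_keys_iff subset_iff sum_distrib_left mult.assoc) (metis mult_zero_right)
  qed
  have varpow: "Var a ^ i = Poly_Mapping.single (Poly_Mapping.single a i) (1::('v,rat) mpoly)" for a :: 'u and i
    by (induction i) (auto simp: Var_def mult_single simp flip: single_add single_one)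
  have prodvar: "(\<Prod>a\<in>S. Var a ^ e a) = Poly_Mapping.single (\<Sum>a\<in>S. Poly_Mapping.single a (e a)) (1::('v,rat) mpoly)"
    if "finite S" for S :: "'u set" and e
    using that by (induction S) (auto simp: varpow mult_single simp flip: single_one)
  have E1: "E 1 = 1" using sing[of 0 1] by (simp add: w_def)
  have Evar: "E (Var a ^ i) = m a i" for a i
    by (cases "i = 0") (auto simp: varpow sing w_def m0 E1)
  have "E (\<Prod>a\<in>S. Var a ^ e a) = (\<Prod>a\<in>S. E (Var a ^ e a))" if S: "finite S" for S e
  proof -
    have l: "Poly_Mapping.lookup (\<Sum>a\<in>S. Poly_Mapping.single a (e a)) b = (if b \<in> S then e b else 0)" for b
      using S by (simp add: lookup_sum lookup_single when_def)
    have "w (\<Sum>a\<in>S. Poly_Mapping.single a (e a)) = (\<Prod>a\<in>S. m a (e a))"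
      unfolding w_def using S by (intro prod.mono_neutral_cong_left) (auto simp: l m0 in_keys_iff split: if_splits)
    then show ?thesis by (simp add: prodvar[OF S] sing Evar)
  qed
  then have "umbral_calculus E" using add scale E1 by unfold_locales auto
  with Evar show ?thesis by blast
qed

definition umb_equiv ::
    "('u, 'v) umbral_fun \<Rightarrow> ('u, 'v) umbral_poly \<Rightarrow> ('u, 'v) umbral_poly \<Rightarrow> bool" where
  "umb_equiv E p q \<longleftrightarrow> E p = E q"

definition umb_similar ::
    "('u, 'v) umbral_fun \<Rightarrow> ('u, 'v) umbral_poly \<Rightarrow> ('u, 'v) umbral_poly \<Rightarrow> bool" where
  "umb_similar E p q \<longleftrightarrow> (\<forall>i. E (p ^ i) = E (q ^ i))"

definition gen_fun ::
    "('u, 'v) umbral_fun \<Rightarrow> ('u, 'v) umbral_poly \<Rightarrow> ('v, rat) mpoly fps" where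
  "gen_fun E p = Abs_fps (\<lambda>i. Const (1 / fact i) * E (p ^ i))"

definition is_singleton_umbra :: "('u, 'v) umbral_fun \<Rightarrow> 'u \<Rightarrow> bool" where
  "is_singleton_umbra E \<chi> \<longleftrightarrow> gen_fun E (Var \<chi>) = 1 + fps_X"

text \<open>
  \<open>\<delta>\<close> is an auxiliary umbra $-1.p$: its generating function is the multiplicative inverse of that
  of \<open>p\<close>.
\<close>

definition is_neg_one_dot ::
    "('u, 'v) umbral_fun \<Rightarrow> 'u \<Rightarrow> ('u, 'v) umbral_poly \<Rightarrow> bool" where
  "is_neg_one_dot E \<delta> p \<longleftrightarrow> gen_fun E (Var \<delta>) * gen_fun E p = 1"

text \<open>Injectivity of \<open>\<chi>\<close> expresses that the copies of the singleton umbra are uncorrelated.\<close>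

definition is_epsilon_bar :: "('u, 'v::finite) umbral_fun \<Rightarrow> 'u \<Rightarrow> bool" where
  "is_epsilon_bar E \<epsilon> \<longleftrightarrow>
     (\<exists>\<chi> :: 'v \<Rightarrow> 'u. inj \<chi> \<and> (\<forall>i. is_singleton_umbra E (\<chi> i)) \<and>
        umb_similar E (Var \<epsilon>) (\<Sum>i\<in>UNIV. Const (Var i) * Var (\<chi> i)))"

definition is_theta_bar :: "('u, 'v::finite) umbral_fun \<Rightarrow> 'u \<Rightarrow> bool" where
  "is_theta_bar E \<theta> \<longleftrightarrow>
     (\<exists>\<epsilon> \<delta>. is_epsilon_bar E \<epsilon> \<and> is_neg_one_dot E \<delta> (- Var \<epsilon>) \<and>
        umb_similar E (Var \<theta>) (Var \<delta>))"

end

theory Submission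
  imports Defs "HOL-Library.FuncSet"
begin

text \<open>
  Expanding the parking character in its permutation basis, $n!\,\mathcal{PF}_n$ is the sum, over
  parking functions $p$ and permutations $\sigma$ fixing $p$, of the power sum of the cycle type of
  $\sigma$. That power sum enumerates the colourings of the positions that are constant on the cycles
  of $\sigma$, so for fixed $p$ the sum over $\sigma$ becomes a sum over all colourings $f$, weighted
  by the order of the stabiliser of the pair $(p, f)$. This order is a product of factorials, and
  the exponential formula evaluates the weighted sum as $\prod_k c_k!\,h_{c_k}$, where $c_k$ is the
  number of occurrences of $k$ in $p$. The moments of $\bar\vartheta$ being $i!\,h_i$, this is the
  umbral evaluation of the monomial $y_{p_1}\cdots y_{p_n}$.
\<close>

section \<open>Sums over colourings and stabilisers\<close>

text \<open>Induction on \<open>S\<close>: a label-preserving permutation of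
  \<open>insert a S\<close> is uniquely \<open>transpose a b\<close> after one of \<open>S\<close>,
  with \<open>b\<close> in the fibre of \<open>a\<close>. The count is thus multiplied by the size
  of the enlarged fibre, which raises one factorial to the next. Labels in \<open>B\<close> that do
  not occur contribute \<open>fact 0\<close>.\<close>

lemma card_permutes_preserving:
  fixes q :: "'a \<Rightarrow> 'b"
  assumes "finite S" "finite B" "q ` S \<subseteq> B"
  shows "card {\<sigma>. \<sigma> permutes S \<and> q \<circ> \<sigma> = q} = (\<Prod>b\<in>B. fact (card {j \<in> S. q j = b}))"
  using assms(1,3)
proof (induction S rule: finite_induct)
  case empty
  have eq: "{\<sigma>. \<sigma> permutes {} \<and> q \<circ> \<sigma> = q} = {id}"
    by auto
  show ?case unfolding eq by simp
next
  case (insert a S)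
  let ?P = "\<lambda>S. {\<sigma>. \<sigma> permutes S \<and> q \<circ> \<sigma> = q}"
  let ?F = "{b \<in> insert a S. q b = q a}"
  let ?g = "\<lambda>(b, \<sigma>). transpose a b \<circ> \<sigma>"
  have tr: "q \<circ> transpose a b = q" if "q b = q a" for b
    using that by (auto simp: fun_eq_iff transpose_def)
  have eq: "?P (insert a S) = ?g ` (?F \<times> ?P S)"
  proof (intro equalityI subsetI)
    fix \<sigma> assume \<sigma>: "\<sigma> \<in> ?P (insert a S)"
    then have \<sigma>: "\<sigma> permutes insert a S" "q \<circ> \<sigma> = q" by auto
    define b where "b = \<sigma> a"
    define \<tau> where "\<tau> = transpose a b \<circ> \<sigma>"
    have "b \<in> insert a S" using permutes_in_image[OF \<sigma>(1), of a] by (simp add: b_def)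
    moreover have qb: "q b = q a" using \<sigma>(2) by (simp add: b_def fun_eq_iff)
    moreover have "\<tau> permutes S" using permutes_insert_lemma[OF \<sigma>(1)] by (simp add: \<tau>_def b_def)
    moreover have "q \<circ> \<tau> = q" using \<sigma>(2) tr[OF qb] by (simp add: \<tau>_def o_assoc)
    moreover have "\<sigma> = ?g (b, \<tau>)" by (simp add: \<tau>_def o_assoc)
    ultimately show "\<sigma> \<in> ?g ` (?F \<times> ?P S)" by (intro image_eqI[of _ _ "(b, \<tau>)"]) auto
  next
    fix \<sigma> assume "\<sigma> \<in> ?g ` (?F \<times> ?P S)"
    then obtain b \<tau> where b: "b \<in> insert a S" "q b = q a" "\<tau> permutes S" "q \<circ> \<tau> = q" "\<sigma> = transpose a b \<circ> \<tau>"
      by auto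
    have "\<sigma> permutes insert a S"
      unfolding b(5) using b(1,3)
      by (intro permutes_compose[OF permutes_imp_permutes_insert] permutes_swap_id) auto
    then show "\<sigma> \<in> ?P (insert a S)"
      using b tr[OF b(2)] by (simp add: o_assoc)
  qed
  have inj: "inj_on ?g (?F \<times> ?P S)"
  proof (rule inj_onI, clarify)
    fix b \<tau> b' \<tau>'
    assume *: "transpose a b \<circ> \<tau> = transpose a b' \<circ> \<tau>'" "\<tau> permutes S" "\<tau>' permutes S"
    \<comment> \<open>Both factors fix \<open>a\<close>, so evaluating the two products at
      \<open>a\<close> reads off \<open>b\<close> and \<open>b'\<close>.\<close>
    have "\<tau> a = a" "\<tau>' a = a" using * insert.hyps(2) by (auto intro: permutes_not_in)
    then have "b = b'"
      using fun_cong[OF *(1), of a] by simp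
    moreover have "\<tau> = \<tau>'"
      using arg_cong[OF *(1), of "\<lambda>f. transpose a b \<circ> f"] \<open>b = b'\<close> by (simp add: o_assoc)
    ultimately show "b = b' \<and> \<tau> = \<tau>'" ..
  qed
  have F: "?F = insert a {j \<in> S. q j = q a}" by auto
  have "card (?P (insert a S)) = card ?F * card (?P S)"
    unfolding eq by (simp only: card_image[OF inj] card_cartesian_product)
  also have "card ?F = Suc (card {j \<in> S. q j = q a})"
    unfolding F using insert.hyps by simp
  also have "card (?P S) = (\<Prod>b\<in>B. fact (card {j \<in> S. q j = b}))"
    using insert.IH insert.prems by blast
  also have "\<dots> = fact (card {j \<in> S. q j = q a}) * (\<Prod>b\<in>B - {q a}. fact (card {j \<in> S. q j = b}))"
    using insert.prems \<open>finite B\<close> by (intro prod.remove) auto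
  also have "(\<Prod>b\<in>B - {q a}. fact (card {j \<in> S. q j = b}))
      = (\<Prod>b\<in>B - {q a}. fact (card {j \<in> insert a S. q j = b}))"
    by (intro prod.cong refl arg_cong[where f = "\<lambda>A. fact (card A)"]) auto
  also have "Suc (card {j \<in> S. q j = q a}) * (fact (card {j \<in> S. q j = q a}) * \<dots>)
      = fact (card ?F) * \<dots>"
    unfolding F using insert.hyps by (simp add: algebra_simps)
  also have "\<dots> = (\<Prod>b\<in>B. fact (card {j \<in> insert a S. q j = b}))"
    using insert.prems \<open>finite B\<close> by (intro prod.remove[symmetric]) auto
  finally show ?case .
qed

section \<open>Splitting colourings by their fibres, and the exponential formula\<close>

lemma sum_Pow_card:
  fixes f :: "nat \<Rightarrow> 'a::comm_semiring_1"
  assumes "finite C"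
  shows "(\<Sum>S\<in>Pow C. f (card S)) = (\<Sum>k\<le>card C. of_nat (card C choose k) * f k)"
proof -
  have "(\<Sum>S\<in>Pow C. f (card S)) = (\<Sum>k\<le>card C. \<Sum>S | S \<in> Pow C \<and> card S = k. f (card S))"
    using assms by (intro sum.group[symmetric]) (auto intro: card_mono)
  also have "\<dots> = (\<Sum>k\<le>card C. of_nat (card C choose k) * f k)"
    using n_subsets[OF assms] by (intro sum.cong) simp_all
  finally show ?thesis .
qed

text \<open>A colouring amounts to the set \<open>S\<close> of points coloured \<open>v\<close>
  together with a colouring of the remaining points by \<open>W\<close>; since \<open>v\<close> is
  not in \<open>W\<close>, the set \<open>S\<close> can be recovered.\<close>

lemma sum_PiE_insert:
  fixes F :: "('a \<Rightarrow> 'b) \<Rightarrow> 'c::comm_monoid_add"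
  assumes "finite C" "finite W" "v \<notin> W"
  shows "(\<Sum>f\<in>C \<rightarrow>\<^sub>E insert v W. F f)
    = (\<Sum>S\<in>Pow C. \<Sum>g\<in>(C - S) \<rightarrow>\<^sub>E W. F (\<lambda>j. if j \<in> S then v else g j))"
proof -
  have "(\<Sum>S\<in>Pow C. \<Sum>g\<in>(C - S) \<rightarrow>\<^sub>E W. F (\<lambda>j. if j \<in> S then v else g j))
    = (\<Sum>(S, g)\<in>(SIGMA S:Pow C. (C - S) \<rightarrow>\<^sub>E W). F (\<lambda>j. if j \<in> S then v else g j))"
    using assms by (intro sum.Sigma) (auto intro!: finite_PiE)
  also have "\<dots> = (\<Sum>f\<in>C \<rightarrow>\<^sub>E insert v W. F f)"
    using assms(3)
    by (intro sum.reindex_bij_witness[where j = "\<lambda>(S, g) j. if j \<in> S then v else g j"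
          and i = "\<lambda>f. ({j \<in> C. f j = v}, restrict f {j \<in> C. f j \<noteq> v})"])
      (fastforce simp: fun_eq_iff PiE_iff extensional_def restrict_def split: if_splits)+
  finally show ?thesis ..
qed

text \<open>The product rule for exponential generating functions: the weights m! b(m) have the
  ordinary series of b as their exponential one. Keeping the factorials in the weights avoids
  division in \<open>'r\<close>. Induction on the colours splits off one fibre, and choosing that
  fibre by its size gives the convolution.\<close>

lemma exponential_formula:
  fixes b :: "'v \<Rightarrow> nat \<Rightarrow> 'r::comm_ring_1"
  assumes "finite W" "finite C"
  shows "(\<Sum>f\<in>C \<rightarrow>\<^sub>E W. \<Prod>v\<in>W. of_nat (fact (card {j \<in> C. f j = v})) * b v (card {j \<in> C. f j = v}))
    = of_nat (fact (card C)) * fps_nth (\<Prod>v\<in>W. Abs_fps (b v)) (card C)"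
  using assms
proof (induction W arbitrary: C rule: finite_induct)
  case empty
  \<comment> \<open>Without colours only the empty set has a colouring, which matches the
    coefficients of the constant series 1.\<close>
  then show ?case by (cases "C = {}") (auto simp: PiE_eq_empty_iff)
next
  case (insert v W)
  let ?P = "\<Prod>v\<in>W. Abs_fps (b v)"
  define n where "n = card C"
  have fib: "(\<Sum>g\<in>(C - S) \<rightarrow>\<^sub>E W. \<Prod>w\<in>insert v W.
        of_nat (fact (card {j \<in> C. (if j \<in> S then v else g j) = w}))
          * b w (card {j \<in> C. (if j \<in> S then v else g j) = w}))
      = of_nat (fact (card S)) * b v (card S)
          * (of_nat (fact (n - card S)) * fps_nth ?P (n - card S))"
    if S: "S \<subseteq> C" for S
  proof -
    have 1: "{j \<in> C. (if j \<in> S then v else g j) = v} = S" if "g \<in> (C - S) \<rightarrow>\<^sub>E W" for g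
      using that insert.hyps(2) S by (auto split: if_splits)
    have 2: "{j \<in> C. (if j \<in> S then v else g j) = w} = {j \<in> C - S. g j = w}" if "w \<in> W" for g w
      using that insert.hyps(2) by auto
    have "card (C - S) = n - card S"
      using S insert.prems by (simp add: card_Diff_subset finite_subset n_def)
    with insert.IH[of "C - S"] insert.prems
    have "of_nat (fact (n - card S)) * fps_nth ?P (n - card S)
        = (\<Sum>g\<in>(C - S) \<rightarrow>\<^sub>E W. \<Prod>w\<in>W.
            of_nat (fact (card {j \<in> C - S. g j = w})) * b w (card {j \<in> C - S. g j = w}))"
      by simp
    then show ?thesis
      unfolding sum_distrib_left prod.insert[OF insert.hyps]
      by (simp only: sum_distrib_left) (intro sum.cong prod.cong arg_cong2[where f = "(*)"] refl; simp only: 1 2)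
  qed
  have "(\<Sum>f\<in>C \<rightarrow>\<^sub>E insert v W. \<Prod>w\<in>insert v W.
        of_nat (fact (card {j \<in> C. f j = w})) * b w (card {j \<in> C. f j = w}))
      = (\<Sum>S\<in>Pow C. of_nat (fact (card S)) * b v (card S)
          * (of_nat (fact (n - card S)) * fps_nth ?P (n - card S)))"
    unfolding sum_PiE_insert[OF insert.prems insert.hyps] by (rule sum.cong[OF refl], rule fib) simp
  also have "\<dots> = (\<Sum>k\<le>n. of_nat (n choose k) * (of_nat (fact k) * b v k
          * (of_nat (fact (n - k)) * fps_nth ?P (n - k))))"
    unfolding n_def using insert.prems
    by (rule sum_Pow_card[where f = "\<lambda>k. of_nat (fact k) * b v k
          * (of_nat (fact (card C - k)) * fps_nth (\<Prod>v\<in>W. Abs_fps (b v)) (card C - k))"])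
  also have "\<dots> = (\<Sum>k\<le>n. of_nat (fact n) * (b v k * fps_nth ?P (n - k)))"
  proof (intro sum.cong refl)
    fix k assume "k \<in> {..n}"
    \<comment> \<open>The binomial coefficient enters in product form, as \<open>'r\<close> need not
      allow division by factorials.\<close>
    then have "of_nat (fact n) = (of_nat (fact k) * of_nat (fact (n - k)) * of_nat (n choose k) :: 'r)"
      using binomial_fact_lemma[of k n] by (metis atMost_iff of_nat_mult)
    then show "of_nat (n choose k) * (of_nat (fact k) * b v k * (of_nat (fact (n - k)) * fps_nth ?P (n - k)))
       = of_nat (fact n) * (b v k * fps_nth ?P (n - k))"
      by (simp only: ac_simps)
  qed
  also have "\<dots> = of_nat (fact n) * fps_nth (\<Prod>w\<in>insert v W. Abs_fps (b w)) n"
    using insert.hyps by (simp add: fps_mult_nth sum_distrib_left atLeast0AtMost)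
  finally show ?case unfolding n_def .
qed

text \<open>Distributivity, with a family of colourings of the fibres of \<open>q\<close> glued into
  one colouring of \<open>C\<close>: the colour of \<open>j\<close> is read from the member with
  index \<open>q j\<close>.\<close>

lemma sum_PiE_partition:
  fixes w :: "'k \<Rightarrow> ('a \<Rightarrow> 'v) \<Rightarrow> 'r::comm_semiring_1"
  assumes "finite C" "finite V" "finite K" "q ` C \<subseteq> K"
  shows "(\<Prod>k\<in>K. \<Sum>f\<in>{j \<in> C. q j = k} \<rightarrow>\<^sub>E V. w k f)
    = (\<Sum>f\<in>C \<rightarrow>\<^sub>E V. \<Prod>k\<in>K. w k (restrict f {j \<in> C. q j = k}))"
proof -
  have "(\<Prod>k\<in>K. \<Sum>f\<in>{j \<in> C. q j = k} \<rightarrow>\<^sub>E V. w k f)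
    = (\<Sum>F\<in>(\<Pi>\<^sub>E k\<in>K. {j \<in> C. q j = k} \<rightarrow>\<^sub>E V). \<Prod>k\<in>K. w k (F k))"
    using assms by (intro prod_sum_PiE) (auto intro!: finite_PiE)
  also have "\<dots> = (\<Sum>f\<in>C \<rightarrow>\<^sub>E V. \<Prod>k\<in>K. w k (restrict f {j \<in> C. q j = k}))"
  proof (intro sum.reindex_bij_witness[where j = "\<lambda>F. \<lambda>j\<in>C. F (q j) j"
          and i = "\<lambda>f. \<lambda>k\<in>K. restrict f {j \<in> C. q j = k}"])
    fix F assume F: "F \<in> (\<Pi>\<^sub>E k\<in>K. {j \<in> C. q j = k} \<rightarrow>\<^sub>E V)"
    then have r: "restrict (\<lambda>j\<in>C. F (q j) j) {j \<in> C. q j = k} = F k" if "k \<in> K" for k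
      using that by (fastforce simp: fun_eq_iff PiE_iff extensional_def restrict_def)
    show "(\<lambda>k\<in>K. restrict (\<lambda>j\<in>C. F (q j) j) {j \<in> C. q j = k}) = F"
      using F r by (auto simp: fun_eq_iff PiE_iff extensional_def)
    show "(\<Prod>k\<in>K. w k (restrict (\<lambda>j\<in>C. F (q j) j) {j \<in> C. q j = k})) = (\<Prod>k\<in>K. w k (F k))"
      using r by simp
    show "(\<lambda>j\<in>C. F (q j) j) \<in> C \<rightarrow>\<^sub>E V"
      using F assms(4) by (fastforce simp: PiE_iff)
  qed (use assms(4) in \<open>auto simp: fun_eq_iff PiE_iff extensional_def restrict_def\<close>)
  finally show ?thesis .
qed

section \<open>Power sums of cycle types and invariant colourings\<close>

text \<open>Expanding the product chooses one colour for each cycle, and the exponent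
  \<open>card c\<close> counts that colour once for every position in the cycle. Such choices are
  the colourings invariant under \<sigma>.\<close>

lemma prod_power_sum_orbits:
  fixes x :: "'v::finite \<Rightarrow> 'r::comm_semiring_1"
  assumes "finite S" "\<sigma> permutes S"
  shows "(\<Prod>c\<in>orbit \<sigma> ` S. \<Sum>i\<in>UNIV. x i ^ card c)
    = (\<Sum>f | f \<in> S \<rightarrow>\<^sub>E UNIV \<and> (\<forall>j\<in>S. f (\<sigma> j) = f j). \<Prod>j\<in>S. x (f j))"
proof -
  let ?O = "orbit \<sigma> ` S"
  have perm: "permutation \<sigma>" using assms permutation_permutes by blast
  \<comment> \<open>An orbit is generated starting from \<open>\<sigma> j\<close>; that it returns
    to \<open>j\<close> depends on \<sigma> being a permutation with finite support.\<close>
  have self: "j \<in> orbit \<sigma> j" for j using perm by (rule permutation_self_in_orbit)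
  have step: "orbit \<sigma> (\<sigma> j) = orbit \<sigma> j" for j using perm by (rule permutation_orbit_step)
  have eqI: "orbit \<sigma> j = c" if "c \<in> ?O" "j \<in> c" for j c
    using that orbit_cyclic_eq3[OF cyclic_on_orbit[OF assms(2,1)]] by auto
  have sub: "c \<subseteq> S" if "c \<in> ?O" for c
    using that permutes_orbit_subset[OF assms(2)] by auto
  have const: "f k = f j" if f: "\<forall>j\<in>S. f (\<sigma> j) = f j" and "k \<in> orbit \<sigma> j" "j \<in> S" 
    for f :: "'a \<Rightarrow> 'v" and j k
    using that(2)
  proof induction
    case base
    then show ?case using f \<open>j \<in> S\<close> by simp
  next
    case (step k)
    then have "k \<in> S" using permutes_orbit_subset[OF assms(2) \<open>j \<in> S\<close>] by auto
    then show ?case using f step.IH by simp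
  qed
  have "(\<Prod>c\<in>?O. \<Sum>i\<in>UNIV. x i ^ card c) = (\<Sum>g\<in>?O \<rightarrow>\<^sub>E UNIV. \<Prod>c\<in>?O. x (g c) ^ card c)"
    using assms by (intro prod_sum_PiE) auto
  \<comment> \<open>The inverse map reads the colour of a cycle at an arbitrarily chosen element; by
    \<open>const\<close> the choice does not matter.\<close>
  also have "\<dots> = (\<Sum>f | f \<in> S \<rightarrow>\<^sub>E UNIV \<and> (\<forall>j\<in>S. f (\<sigma> j) = f j). \<Prod>j\<in>S. x (f j))"
  proof (intro sum.reindex_bij_witness[where j = "\<lambda>g. \<lambda>j\<in>S. g (orbit \<sigma> j)"
          and i = "\<lambda>f. \<lambda>c\<in>?O. f (SOME j. j \<in> c)"])
    fix g :: "'a set \<Rightarrow> 'v" assume g: "g \<in> ?O \<rightarrow>\<^sub>E UNIV"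
    show "(\<lambda>c\<in>?O. (\<lambda>j\<in>S. g (orbit \<sigma> j)) (SOME j. j \<in> c)) = g"
    proof
      fix c
      show "(\<lambda>c\<in>?O. (\<lambda>j\<in>S. g (orbit \<sigma> j)) (SOME j. j \<in> c)) c = g c"
      proof (cases "c \<in> ?O")
        case True
        then have "\<exists>j. j \<in> c" using self by auto
        then have "(SOME j. j \<in> c) \<in> c" by (rule someI_ex)
        moreover from this have "(SOME j. j \<in> c) \<in> S" using sub[OF True] by blast
        ultimately show ?thesis using True eqI[OF True] by simp
      qed (use g in \<open>auto simp: PiE_iff extensional_def\<close>)
    qed
    show "(\<lambda>j\<in>S. g (orbit \<sigma> j)) \<in> {f. f \<in> S \<rightarrow>\<^sub>E UNIV \<and> (\<forall>j\<in>S. f (\<sigma> j) = f j)}"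
      using step permutes_in_image[OF assms(2)] by auto
    have "(\<Prod>j\<in>S. x ((\<lambda>j\<in>S. g (orbit \<sigma> j)) j)) = (\<Prod>j\<in>S. x (g (orbit \<sigma> j)))"
      by simp
    also have "\<dots> = (\<Prod>c\<in>?O. \<Prod>j | j \<in> S \<and> orbit \<sigma> j = c. x (g (orbit \<sigma> j)))"
      using assms(1) by (intro prod.group[symmetric]) auto
    also have "\<dots> = (\<Prod>c\<in>?O. x (g c) ^ card c)"
    proof (intro prod.cong refl)
      fix c assume c: "c \<in> ?O"
      have "{j. j \<in> S \<and> orbit \<sigma> j = c} = c" using eqI[OF c] sub[OF c] self by blast
      moreover have "(\<Prod>j | j \<in> S \<and> orbit \<sigma> j = c. x (g (orbit \<sigma> j)))
          = (\<Prod>j | j \<in> S \<and> orbit \<sigma> j = c. x (g c))"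
        by (rule prod.cong) auto
      ultimately show "(\<Prod>j | j \<in> S \<and> orbit \<sigma> j = c. x (g (orbit \<sigma> j))) = x (g c) ^ card c"
        by simp
    qed
    finally show "(\<Prod>j\<in>S. x ((\<lambda>j\<in>S. g (orbit \<sigma> j)) j)) = (\<Prod>c\<in>?O. x (g c) ^ card c)" .
  next
    fix f :: "'a \<Rightarrow> 'v" assume f: "f \<in> {f. f \<in> S \<rightarrow>\<^sub>E UNIV \<and> (\<forall>j\<in>S. f (\<sigma> j) = f j)}"
    have "f (SOME k. k \<in> orbit \<sigma> j) = f j" if "j \<in> S" for j
      using f that someI[of "\<lambda>k. k \<in> orbit \<sigma> j", OF self] by (intro const) auto
    then show "(\<lambda>j\<in>S. (\<lambda>c\<in>?O. f (SOME j. j \<in> c)) (orbit \<sigma> j)) = f"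
      using f by (auto simp: fun_eq_iff PiE_iff extensional_def)
  qed auto
  finally show ?thesis .
qed

text \<open>After exchanging the sums, a colouring \<open>f\<close> is weighted by the number of
  permutations preserving the pair of \<open>q\<close> and \<open>f\<close>, a product of
  factorials. This weight factors over the fibres of \<open>q\<close>, where the exponential formula
  applies. The product of geometric series generates the complete homogeneous polynomials, so each
  factor is c! times the one of degree c.\<close>

lemma sum_stabilizer_power_sums:
  fixes x :: "'v::finite \<Rightarrow> 'r::comm_ring_1" and q :: "'a \<Rightarrow> 'k"
  assumes "finite C" "finite K" "q ` C \<subseteq> K"
  shows "(\<Sum>\<sigma> | \<sigma> permutes C \<and> (\<forall>j\<in>C. q (\<sigma> j) = q j). \<Prod>c\<in>orbit \<sigma> ` C. \<Sum>i\<in>UNIV. x i ^ card c)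
    = (\<Prod>k\<in>K. of_nat (fact (card {j \<in> C. q j = k}))
        * fps_nth (\<Prod>v\<in>UNIV. Abs_fps (\<lambda>m. x v ^ m)) (card {j \<in> C. q j = k}))"
proof -
  let ?P = "{\<sigma>. \<sigma> permutes C \<and> (\<forall>j\<in>C. q (\<sigma> j) = q j)}"
  let ?m = "\<lambda>f k v. card {j \<in> C. q j = k \<and> f j = v}"
  have finP: "finite {\<sigma>. \<sigma> permutes C}" using assms(1) by (rule finite_permutations)
  have finF: "finite (C \<rightarrow>\<^sub>E (UNIV :: 'v set))" using assms(1) by (intro finite_PiE) auto
  have stab: "of_nat (card {\<sigma> \<in> ?P. \<forall>j\<in>C. f (\<sigma> j) = f j}) * (\<Prod>j\<in>C. x (f j))
      = (\<Prod>k\<in>K. \<Prod>v\<in>UNIV. of_nat (fact (?m f k v)) * x v ^ ?m f k v)" for f :: "'a \<Rightarrow> 'v"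
  proof -
    let ?q = "\<lambda>j. (q j, f j)"
    have "{\<sigma> \<in> ?P. \<forall>j\<in>C. f (\<sigma> j) = f j} = {\<sigma>. \<sigma> permutes C \<and> ?q \<circ> \<sigma> = ?q}"
    proof (intro Collect_cong, simp, intro iffI conjI; (elim conjE)?)
      fix \<sigma> assume *: "\<sigma> permutes C" "\<forall>j\<in>C. q (\<sigma> j) = q j" "\<forall>j\<in>C. f (\<sigma> j) = f j"
      show "?q \<circ> \<sigma> = ?q"
      proof
        \<comment> \<open>Invariance is known on \<open>C\<close> only; outside it \<sigma> is the
          identity.\<close>
        fix j show "(?q \<circ> \<sigma>) j = ?q j"
          using * permutes_not_in[OF *(1), of j] by (cases "j \<in> C") auto
      qed
    qed (auto simp: fun_eq_iff)
    also have "card \<dots> = (\<Prod>b\<in>K \<times> UNIV. fact (card {j \<in> C. ?q j = b}))"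
      using assms by (intro card_permutes_preserving) auto
    also have "\<dots> = (\<Prod>k\<in>K. \<Prod>v\<in>UNIV. fact (?m f k v))"
      by (simp add: prod.cartesian_product case_prod_unfold prod_eq_iff)
    finally have card: "card {\<sigma> \<in> ?P. \<forall>j\<in>C. f (\<sigma> j) = f j} = (\<Prod>k\<in>K. \<Prod>v\<in>UNIV. fact (?m f k v))" .
    have "(\<Prod>j\<in>C. x (f j)) = (\<Prod>b\<in>K \<times> UNIV. \<Prod>j | j \<in> C \<and> ?q j = b. x (f j))"
      using assms by (intro prod.group[symmetric]) auto
    also have "\<dots> = (\<Prod>k\<in>K. \<Prod>v\<in>UNIV. x v ^ ?m f k v)"
    proof -
      have "(\<Prod>j | j \<in> C \<and> ?q j = b. x (f j)) = (\<Prod>j | j \<in> C \<and> q j = fst b \<and> f j = snd b. x (snd b))"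
        for b by (intro prod.cong) auto
      then show ?thesis by (simp add: prod.cartesian_product case_prod_unfold)
    qed
    finally have "(\<Prod>j\<in>C. x (f j)) = (\<Prod>k\<in>K. \<Prod>v\<in>UNIV. x v ^ ?m f k v)" .
    then show ?thesis unfolding card by (simp add: prod.distrib)
  qed
  have "(\<Sum>\<sigma>\<in>?P. \<Prod>c\<in>orbit \<sigma> ` C. \<Sum>i\<in>UNIV. x i ^ card c)
      = (\<Sum>\<sigma>\<in>?P. \<Sum>f | f \<in> C \<rightarrow>\<^sub>E UNIV \<and> (\<forall>j\<in>C. f (\<sigma> j) = f j). \<Prod>j\<in>C. x (f j))"
    using assms(1) by (intro sum.cong refl prod_power_sum_orbits) auto
  also have "\<dots> = (\<Sum>f\<in>C \<rightarrow>\<^sub>E UNIV. \<Sum>\<sigma> | \<sigma> \<in> ?P \<and> (\<forall>j\<in>C. f (\<sigma> j) = f j). \<Prod>j\<in>C. x (f j))"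
    using finP finF by (intro sum.swap_restrict) auto
  also have "\<dots> = (\<Sum>f\<in>C \<rightarrow>\<^sub>E UNIV. \<Prod>k\<in>K. \<Prod>v\<in>UNIV. of_nat (fact (?m f k v)) * x v ^ ?m f k v)"
    by (simp only: sum_constant stab)
  \<comment> \<open>Written with restrictions, the factor for \<open>k\<close> depends only on the
    colouring of its own fibre, as \<open>sum_PiE_partition\<close> demands.\<close>
  also have "\<dots> = (\<Sum>f\<in>C \<rightarrow>\<^sub>E UNIV. \<Prod>k\<in>K. \<Prod>v\<in>UNIV.
        of_nat (fact (card {j \<in> {j \<in> C. q j = k}. restrict f {j \<in> C. q j = k} j = v}))
          * x v ^ card {j \<in> {j \<in> C. q j = k}. restrict f {j \<in> C. q j = k} j = v})"
  proof -
    have "{j \<in> {j \<in> C. q j = k}. restrict f {j \<in> C. q j = k} j = v} = {j \<in> C. q j = k \<and> f j = v}"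
      for f :: "'a \<Rightarrow> 'v" and k v by auto
    then show ?thesis by simp
  qed
  also have "\<dots> = (\<Prod>k\<in>K. \<Sum>f\<in>{j \<in> C. q j = k} \<rightarrow>\<^sub>E UNIV. \<Prod>v\<in>UNIV.
        of_nat (fact (card {j \<in> {j \<in> C. q j = k}. f j = v})) * x v ^ card {j \<in> {j \<in> C. q j = k}. f j = v})"
    using assms by (subst sum_PiE_partition[of C UNIV K q]) auto
  also have "\<dots> = (\<Prod>k\<in>K. of_nat (fact (card {j \<in> C. q j = k}))
        * fps_nth (\<Prod>v\<in>UNIV. Abs_fps (\<lambda>m. x v ^ m)) (card {j \<in> C. q j = k}))"
    using assms(1) by (intro prod.cong refl exponential_formula) auto
  finally show ?thesis .
qed

section \<open>Multivariate polynomials\<close>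

lemma Const_0 [simp]: "Const 0 = 0"
  by (simp add: Const_def)

lemma Const_1 [simp]: "Const 1 = 1"
  by (simp add: Const_def)

lemma Const_add: "Const (a + b :: 'c::monoid_add) = Const a + Const b"
  by (simp add: Const_def single_add)

lemma Const_mult: "Const (a * b :: 'c::semiring_0) = Const a * Const b"
  by (simp add: Const_def mult_single)

lemma Const_power: "Const (a ^ k :: 'c::comm_semiring_1) = Const a ^ k"
  by (induction k) (simp_all add: Const_mult)

lemma Const_prod: "Const (\<Prod>i\<in>A. f i :: 'c::comm_semiring_1) = (\<Prod>i\<in>A. Const (f i))"
  by (induction A rule: infinite_finite_induct) (simp_all add: Const_mult)

lemma Const_uminus: "Const (- a :: 'c::comm_ring_1) = - Const a"
  by (simp add: Const_def single_uminus)

lemma Const_of_nat: "Const (of_nat k :: 'c::comm_semiring_1) = of_nat k"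
  by (induction k) (simp_all add: Const_add)

lemma fact_mult_Const: "(fact k :: ('v, 'c::field_char_0) mpoly) * Const (1 / fact k) = 1"
proof -
  have "(fact k :: ('v, 'c) mpoly) = Const (fact k)"
    by (metis Const_of_nat of_nat_fact)
  then show ?thesis by (simp flip: Const_mult)
qed

lemma prod_Var_eq_single:
  "(\<Prod>i\<in>A. Var (g i)) = Poly_Mapping.single (\<Sum>i\<in>A. Poly_Mapping.single (g i) 1) (1 :: 'c::comm_semiring_1)"
  by (induction A rule: infinite_finite_induct) (auto simp: Var_def mult_single)

section \<open>Substitution into polynomials\<close>

lemma mpoly_subst_single:
  assumes "\<phi> 0 = 0"
  shows "mpoly_subst \<phi> y (Poly_Mapping.single m c)
    = \<phi> c * (\<Prod>v\<in>Poly_Mapping.keys m. y v ^ Poly_Mapping.lookup m v)"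
  using assms by (cases "c = 0") (simp_all add: mpoly_subst_def)

lemma mpoly_subst_add:
  assumes "\<phi> 0 = 0" "\<And>a b. \<phi> (a + b) = \<phi> a + \<phi> b"
  shows "mpoly_subst \<phi> y (p + q) = mpoly_subst \<phi> y p + mpoly_subst \<phi> y q"
proof -
  let ?e = "\<lambda>m. \<Prod>v\<in>Poly_Mapping.keys m. y v ^ Poly_Mapping.lookup m v"
  let ?S = "Poly_Mapping.keys p \<union> Poly_Mapping.keys q"
  \<comment> \<open>Cancellation may remove keys from \<open>p + q\<close>, so all three sums are
    extended to one common key set; the added terms vanish by \<open>\<phi> 0 = 0\<close>.\<close>
  have ext: "mpoly_subst \<phi> y r = (\<Sum>m\<in>?S. \<phi> (Poly_Mapping.lookup r m) * ?e m)"
    if "Poly_Mapping.keys r \<subseteq> ?S" for r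
    unfolding mpoly_subst_def using that assms(1)
    by (intro sum.mono_neutral_left) (auto simp: in_keys_iff)
  show ?thesis
    using Poly_Mapping.keys_add[of p q]
    by (simp add: ext lookup_add assms(2) distrib_right sum.distrib)
qed

lemma mpoly_subst_sum:
  assumes "\<phi> 0 = 0" "\<And>a b. \<phi> (a + b) = \<phi> a + \<phi> b"
  shows "mpoly_subst \<phi> y (\<Sum>i\<in>A. p i) = (\<Sum>i\<in>A. mpoly_subst \<phi> y (p i))"
  by (induction A rule: infinite_finite_induct)
    (simp_all add: mpoly_subst_add[OF assms] mpoly_subst_def[of _ _ 0])

text \<open>Equal letters of the word are collected into one monomial whose exponents are fibre
  sizes, and after substitution the powers are spread out over the positions again.\<close>

lemma mpoly_subst_Const_mult_prod_Var:
  fixes c :: "'c::comm_semiring_1"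
  assumes "\<phi> 0 = 0" "finite A"
  shows "mpoly_subst \<phi> y (Const c * (\<Prod>i\<in>A. Var (g i))) = \<phi> c * (\<Prod>i\<in>A. y (g i))"
proof -
  define m where "m = (\<Sum>i\<in>A. Poly_Mapping.single (g i) (1::nat))"
  have lookup: "Poly_Mapping.lookup m v = card {i \<in> A. g i = v}" for v
    using assms(2) by (simp add: m_def lookup_sum lookup_single when_def sum.If_cases Int_def)
  have keys: "Poly_Mapping.keys m = g ` A"
    using assms(2) by (auto simp: in_keys_iff lookup)
  have "Const c * (\<Prod>i\<in>A. Var (g i)) = Poly_Mapping.single m c"
    by (simp add: prod_Var_eq_single m_def Const_def mult_single)
  then have "mpoly_subst \<phi> y (Const c * (\<Prod>i\<in>A. Var (g i)))
      = \<phi> c * (\<Prod>v\<in>g ` A. y v ^ card {i \<in> A. g i = v})"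
    using assms(1) by (simp add: mpoly_subst_single keys lookup)
  also have "(\<Prod>v\<in>g ` A. y v ^ card {i \<in> A. g i = v}) = (\<Prod>v\<in>g ` A. \<Prod>i | i \<in> A \<and> g i = v. y (g i))"
    by (intro prod.cong refl) simp
  also have "\<dots> = (\<Prod>i\<in>A. y (g i))"
    using assms(2) by (intro prod.group) auto
  finally show ?thesis .
qed

lemma mpoly_subst_volume_poly:
  assumes "\<phi> 0 = 0" "\<And>a b. \<phi> (a + b) = \<phi> a + \<phi> b"
  shows "mpoly_subst \<phi> y (volume_poly n) = \<phi> (1 / fact n) * (\<Sum>p\<in>park n. \<Prod>i<n. y (p ! i))"
  by (simp add: volume_poly_def sum_distrib_left mpoly_subst_sum[OF assms]
      mpoly_subst_Const_mult_prod_Var[where \<phi> = \<phi>, OF assms(1)])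

section \<open>Generating functions of umbrae\<close>

context umbral_calculus
begin

lemma E_zero: "E 0 = 0"
  using E_scale[of 0 0] by simp

lemma E_sum: "E (\<Sum>i\<in>A. p i) = (\<Sum>i\<in>A. E (p i))"
  by (induction A rule: infinite_finite_induct) (simp_all add: E_zero E_add)

lemma E_Const: "E (Const c) = c"
  using E_scale[of c 1] by (simp add: E_one)

text \<open>Distinct symbols are uncorrelated, so injectivity of \<theta> is what permits factoring;
  \<open>inv_into\<close> carries the exponents from indices to symbols.\<close>

lemma E_prod_distinct:
  assumes "finite K" "inj_on \<theta> K"
  shows "E (\<Prod>k\<in>K. Var (\<theta> k) ^ e k) = (\<Prod>k\<in>K. E (Var (\<theta> k) ^ e k))"
  using E_uncorrelated[of "\<theta> ` K" "\<lambda>\<alpha>. e (inv_into K \<theta> \<alpha>)"] assms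
  by (simp add: prod.reindex inv_into_f_f cong: prod.cong)

lemma moment_gen_fun: "E (p ^ k) = of_nat (fact k) * fps_nth (gen_fun E p) k"
  unfolding gen_fun_def by (simp add: fact_mult_Const flip: mult.assoc)

lemma gen_fun_cong: "umb_similar E p q \<Longrightarrow> gen_fun E p = gen_fun E q"
  by (simp add: gen_fun_def umb_similar_def)

lemma umb_similar_uminus:
  assumes "umb_similar E p q"
  shows "umb_similar E (- p) (- q)"
proof -
  have "E ((- p) ^ k) = (- 1) ^ k * E (p ^ k)" for p k
  proof -
    have "(- p) ^ k = Const ((- 1) ^ k) * p ^ k"
      by (simp add: Const_power Const_uminus flip: power_mult_distrib)
    then show ?thesis by (simp only: E_scale)
  qed
  then show ?thesis using assms by (simp add: umb_similar_def)
qed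

text \<open>Generating functions of uncorrelated umbrae multiply, and the scalar \<open>a i\<close>
  rescales t to \<open>a i\<close> times t. The k-th power of the sum expands into words, that is
  colourings of k positions; \<open>E\<close> factors over their fibres and the exponential formula
  sums the results.\<close>

lemma gen_fun_sum_Const_Var:
  fixes \<chi> :: "'w::finite \<Rightarrow> 'u"
  assumes "inj \<chi>"
  shows "gen_fun E (\<Sum>i\<in>UNIV. Const (a i) * Var (\<chi> i))
    = (\<Prod>i\<in>UNIV. Abs_fps (\<lambda>m. a i ^ m * fps_nth (gen_fun E (Var (\<chi> i))) m))" (is "_ = ?R")
proof (rule fps_ext)
  fix k :: nat
  let ?y = "\<lambda>i. Const (a i) * Var (\<chi> i)"
  let ?C = "{..<k}"
  let ?m = "\<lambda>f i. card {j \<in> ?C. f j = i}"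
  have E_fibers: "E (\<Prod>j\<in>?C. ?y (f j))
      = (\<Prod>i\<in>UNIV. of_nat (fact (?m f i)) * (a i ^ ?m f i * fps_nth (gen_fun E (Var (\<chi> i))) (?m f i)))"
    for f :: "nat \<Rightarrow> 'w"
  proof -
    have "(\<Prod>j\<in>?C. ?y (f j)) = (\<Prod>i\<in>UNIV. \<Prod>j | j \<in> ?C \<and> f j = i. ?y (f j))"
      by (intro prod.group[symmetric]) auto
    also have "\<dots> = (\<Prod>i\<in>UNIV. ?y i ^ ?m f i)"
      by (intro prod.cong refl) simp
    also have "\<dots> = Const (\<Prod>i\<in>UNIV. a i ^ ?m f i) * (\<Prod>i\<in>UNIV. Var (\<chi> i) ^ ?m f i)"
      by (simp add: Const_prod Const_power power_mult_distrib prod.distrib)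
    finally show ?thesis
      by (simp add: E_scale E_prod_distinct[OF _ assms] moment_gen_fun[of "Var _"] mult_ac flip: prod.distrib)
  qed
  have "(\<Sum>i\<in>UNIV. ?y i) ^ k = (\<Prod>j\<in>?C. \<Sum>i\<in>UNIV. ?y i)"
    by simp
  also have "\<dots> = (\<Sum>f\<in>?C \<rightarrow>\<^sub>E UNIV. \<Prod>j\<in>?C. ?y (f j))"
    by (intro prod_sum_PiE) auto
  finally have "E ((\<Sum>i\<in>UNIV. ?y i) ^ k)
      = (\<Sum>f\<in>?C \<rightarrow>\<^sub>E UNIV. \<Prod>i\<in>UNIV.
          of_nat (fact (?m f i)) * (a i ^ ?m f i * fps_nth (gen_fun E (Var (\<chi> i))) (?m f i)))"
    by (simp only: E_sum E_fibers)
  also have "\<dots> = of_nat (fact k) * fps_nth ?R k"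
    using exponential_formula[of UNIV ?C "\<lambda>i m. a i ^ m * fps_nth (gen_fun E (Var (\<chi> i))) m"] by simp
  finally have "fps_nth (gen_fun E (\<Sum>i\<in>UNIV. ?y i)) k = (fact k * Const (1 / fact k)) * fps_nth ?R k"
    unfolding gen_fun_def by (simp add: mult_ac)
  then show "fps_nth (gen_fun E (\<Sum>i\<in>UNIV. ?y i)) k = fps_nth ?R k"
    by (simp add: fact_mult_Const)
qed

end

text \<open>The series of the negated umbra \<epsilon> is the product of the 1 - x_i t, and its
  inverse is a product of geometric series. This is the series met in
  \<open>sum_stabilizer_power_sums\<close>, which makes the two sides of the theorem
  comparable.\<close>

lemma gen_fun_theta_bar:
  fixes E :: "('u, 'v::finite) umbral_fun"
  assumes "umbral_calculus E" "is_theta_bar E \<theta>"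
  shows "gen_fun E (Var \<theta>) = (\<Prod>i\<in>UNIV. Abs_fps (\<lambda>m. Var i ^ m))"
proof -
  interpret umbral_calculus E by fact
  obtain \<epsilon> \<delta> \<chi> where \<delta>: "gen_fun E (Var \<delta>) * gen_fun E (- Var \<epsilon>) = 1"
    and \<theta>: "umb_similar E (Var \<theta>) (Var \<delta>)"
    and \<chi>: "inj \<chi>" "\<And>i. gen_fun E (Var (\<chi> i)) = 1 + fps_X"
    and \<epsilon>: "umb_similar E (Var \<epsilon>) (\<Sum>i\<in>UNIV. Const (Var i) * Var (\<chi> i))"
    using assms(2) unfolding is_theta_bar_def is_epsilon_bar_def is_neg_one_dot_def is_singleton_umbra_def
    by blast
  \<comment> \<open>The sign is absorbed into the scalars, so the product formula applies with
    coefficients -x_i.\<close>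
  have "gen_fun E (- Var \<epsilon>) = gen_fun E (\<Sum>i\<in>UNIV. Const (- Var i) * Var (\<chi> i))"
    using gen_fun_cong[OF umb_similar_uminus[OF \<epsilon>]] by (simp add: Const_uminus sum_negf)
  also have "\<dots> = (\<Prod>i\<in>UNIV. 1 - fps_const (Var i) * fps_X)"
    unfolding gen_fun_sum_Const_Var[OF \<chi>(1)] \<chi>(2)
    by (intro prod.cong refl fps_ext) (auto simp: fps_X_nth le_Suc_eq)
  finally have \<epsilon>': "gen_fun E (- Var \<epsilon>) = (\<Prod>i\<in>UNIV. 1 - fps_const (Var i) * fps_X)" .
  have geom: "(1 - fps_const x * fps_X) * Abs_fps (\<lambda>m. x ^ m) = 1" for x :: "('v, rat) mpoly"
  proof (rule fps_ext)
    fix m show "fps_nth ((1 - fps_const x * fps_X) * Abs_fps (\<lambda>m. x ^ m)) m = fps_nth 1 m"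
      by (cases m) (simp_all add: left_diff_distrib mult.assoc)
  qed
  have "gen_fun E (Var \<theta>) = gen_fun E (Var \<delta>)"
    using \<theta> by (rule gen_fun_cong)
  \<comment> \<open>A factor equal to 1 is inserted; its first half then cancels against the series
    of \<delta>.\<close>
  also have "\<dots> = gen_fun E (Var \<delta>)
      * ((\<Prod>i\<in>UNIV. 1 - fps_const (Var i) * fps_X) * (\<Prod>i\<in>UNIV. Abs_fps (\<lambda>m. Var i ^ m)))"
    by (simp add: geom flip: prod.distrib)
  also have "\<dots> = (\<Prod>i\<in>UNIV. Abs_fps (\<lambda>m. Var i ^ m))"
    using \<delta> by (simp add: \<epsilon>' flip: mult.assoc)
  finally show ?thesis .
qed

section \<open>The parking character\<close>

text \<open>An entry sits at some index i < n of the sorted list and is therefore at most i + 1.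
  This gives finiteness of \<open>park n\<close> and confines the umbrae that occur to the indices
  from 1 to n.\<close>

lemma park_nth:
  assumes "p \<in> park n" "j < n"
  shows "p ! j \<in> {1..n}"
proof -
  have len: "length p = n" and pos: "\<forall>k\<in>set p. 0 < k" and le: "\<forall>j<n. sort p ! j \<le> Suc j"
    using assms(1) by (simp_all add: park_def)
  have "p ! j \<in> set p" using len assms(2) by simp
  moreover from this have "p ! j \<in> set (sort p)" by simp
  then obtain i where "i < n" "sort p ! i = p ! j"
    using len by (metis in_set_conv_nth length_sort)
  ultimately show ?thesis using pos le by (metis Suc_leI atLeastAtMost_iff One_nat_def order.trans)
qed

lemma finite_park: "finite (park n)"
proof (rule finite_subset)
  show "park n \<subseteq> {p. set p \<subseteq> {1..n} \<and> length p = n}"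
    using park_nth by (fastforce simp: park_def in_set_conv_nth)
qed (rule finite_lists_length_eq, simp)

text \<open>The action permutes the basis, so its trace counts fixed basis elements; \<sigma> and
  its inverse fix the same ones.\<close>

lemma parking_character_eq_card:
  assumes "\<sigma> permutes {..<n}"
  shows "parking_character n \<sigma> = of_nat (card {p \<in> park n. \<forall>j<n. p ! \<sigma> j = p ! j})"
proof -
  have "permute_list (inv \<sigma>) p = p \<longleftrightarrow> (\<forall>j<n. p ! \<sigma> j = p ! j)" if "p \<in> park n" for p
  proof -
    have len: "length p = n" using that by (simp add: park_def)
    have inv: "inv \<sigma> permutes {..<n}" using assms by (rule permutes_inv)
    have "permute_list (inv \<sigma>) p = p \<longleftrightarrow> (\<forall>j<n. p ! inv \<sigma> j = p ! j)"
      using len inv by (auto simp: list_eq_iff_nth_eq permute_list_nth)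
    also have "\<dots> \<longleftrightarrow> (\<forall>j<n. p ! \<sigma> j = p ! j)"
      using permutes_in_image[OF assms] permutes_in_image[OF inv] permutes_inverses[OF assms]
      by (metis lessThan_iff)
    finally show ?thesis .
  qed
  then show ?thesis
    unfolding parking_character_def basis_trace_def
    by (simp add: parking_action_single lookup_single when_def sum.If_cases finite_park Int_def cong: conj_cong)
qed

lemma power_sum_partition_cycle_type:
  "power_sum_partition (cycle_type n \<sigma>) = (\<Prod>c\<in>orbit \<sigma> ` {..<n}. power_sum (card c))"
  by (simp add: power_sum_partition_def cycle_type_def prod_unfold_prod_mset image_mset.compositionality o_def)

text \<open>Each character value is a count of fixed parking functions, so the Frobenius sum runs
  over pairs of a permutation and a parking function it fixes, and can be summed in the other
  order.\<close>

lemma PF_eq_sum_stabilizers: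
  "PF n = Const (1 / fact n) * (\<Sum>p\<in>park n. \<Sum>\<sigma> | \<sigma> permutes {..<n} \<and> (\<forall>j<n. p ! \<sigma> j = p ! j).
     \<Prod>c\<in>orbit \<sigma> ` {..<n}. power_sum (card c) :: ('v::finite, rat) mpoly)"
proof -
  let ?P = "\<lambda>\<sigma>. \<Prod>c\<in>orbit \<sigma> ` {..<n}. power_sum (card c) :: ('v, rat) mpoly"
  have "(\<Sum>\<sigma> | \<sigma> permutes {..<n}. Const (parking_character n \<sigma>) * power_sum_partition (cycle_type n \<sigma>))
      = (\<Sum>\<sigma> | \<sigma> permutes {..<n}. \<Sum>p | p \<in> park n \<and> (\<forall>j<n. p ! \<sigma> j = p ! j). ?P \<sigma>)"
    by (intro sum.cong refl)
      (simp add: parking_character_eq_card Const_of_nat power_sum_partition_cycle_type)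
  also have "\<dots> = (\<Sum>p\<in>park n. \<Sum>\<sigma> | \<sigma> \<in> {\<sigma>. \<sigma> permutes {..<n}} \<and> (\<forall>j<n. p ! \<sigma> j = p ! j). ?P \<sigma>)"
    by (intro sum.swap_restrict) (simp_all add: finite_permutations finite_park)
  finally show ?thesis
    by (simp add: PF_def frobenius_def)
qed

theorem theorem3p2:
  fixes E :: "('u, 'v::finite) umbral_fun"
    and \<theta>\<^sub>0 :: 'u
    and \<theta> :: "nat \<Rightarrow> 'u"
    and n :: nat
  assumes "1 \<le> n"
    and "CARD('v) = n"
    and "umbral_calculus E"
    and "is_theta_bar E \<theta>\<^sub>0"
    and "inj_on \<theta> {1..n}"
    and "\<And>i. i \<in> {1..n} \<Longrightarrow> umb_similar E (Var (\<theta> i)) (Var \<theta>\<^sub>0)"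
  shows "umb_equiv E
           (mpoly_subst (\<lambda>c. Const (Const c)) (\<lambda>i. Var (\<theta> i)) (volume_poly n))
           (Const (PF n))"
proof -
  interpret umbral_calculus E by fact
  let ?H = "\<Prod>v\<in>UNIV. Abs_fps (\<lambda>m. Var v ^ m) :: ('v, rat) mpoly fps"
  have gen: "gen_fun E (Var (\<theta> k)) = ?H" if "k \<in> {1..n}" for k
    using gen_fun_cong[OF assms(6)[OF that]] gen_fun_theta_bar[OF assms(3,4)] by simp
  \<comment> \<open>Both sides of the theorem carry the factor 1/n! and a sum over parking
    functions, so it suffices to match the terms for each \<open>p\<close>.\<close>
  have E_word: "E (\<Prod>j<n. Var (\<theta> (p ! j)))
      = (\<Sum>\<sigma> | \<sigma> permutes {..<n} \<and> (\<forall>j<n. p ! \<sigma> j = p ! j). \<Prod>c\<in>orbit \<sigma> ` {..<n}. power_sum (card c))"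
    if p: "p \<in> park n" for p
  proof -
    let ?c = "\<lambda>k. card {j \<in> {..<n}. p ! j = k}"
    have sub: "(!) p ` {..<n} \<subseteq> {1..n}" using park_nth[OF p] by auto
    have "(\<Prod>j<n. Var (\<theta> (p ! j))) = (\<Prod>k\<in>{1..n}. \<Prod>j | j \<in> {..<n} \<and> p ! j = k. Var (\<theta> (p ! j)) :: ('u, 'v) umbral_poly)"
      using sub by (intro prod.group[symmetric]) auto
    also have "\<dots> = (\<Prod>k\<in>{1..n}. Var (\<theta> k) ^ ?c k)"
      by (intro prod.cong refl) simp
    finally have "E (\<Prod>j<n. Var (\<theta> (p ! j))) = (\<Prod>k\<in>{1..n}. E (Var (\<theta> k) ^ ?c k))"
      using E_prod_distinct[OF _ assms(5)] by simp
    also have "\<dots> = (\<Prod>k\<in>{1..n}. of_nat (fact (?c k)) * fps_nth ?H (?c k))"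
      by (intro prod.cong refl) (simp only: moment_gen_fun gen)
    also have "\<dots> = (\<Sum>\<sigma> | \<sigma> permutes {..<n} \<and> (\<forall>j\<in>{..<n}. p ! \<sigma> j = p ! j).
        \<Prod>c\<in>orbit \<sigma> ` {..<n}. \<Sum>i\<in>UNIV. Var i ^ card c)"
      \<comment> \<open>Positions are labelled by the entries of \<open>p\<close>; values between 1
        and n missing from \<open>p\<close> have empty fibres and contribute 1.\<close>
      using sub by (intro sum_stabilizer_power_sums[symmetric]) auto
    finally show ?thesis by (simp add: power_sum_def Ball_def)
  qed
  \<comment> \<open>The inner \<open>Const\<close> takes rationals into R, the outer one takes R
    into R[A].\<close>
  have "mpoly_subst (\<lambda>c. Const (Const c)) (\<lambda>i. Var (\<theta> i)) (volume_poly n)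
      = Const (Const (1 / fact n)) * (\<Sum>p\<in>park n. \<Prod>j<n. Var (\<theta> (p ! j)) :: ('u, 'v) umbral_poly)"
    by (intro mpoly_subst_volume_poly) (simp_all add: Const_add)
  then show ?thesis
    by (simp add: umb_equiv_def E_scale E_sum E_word E_Const PF_eq_sum_stabilizers)
qed

end
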